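(* There exists a function $f:\mathbb{N}\to[0,\infty)$ with $\lim_{k\to\infty} f(k)=0$ such that for every integer $k\ge 2$, no (possibly randomized, possibly exponential-time) online algorithm for the $k$-uniform online hypergraph matching problem is $\frac{2+f(k)}{k}$-competitive.
   Context: Online hypergraph matching (edge-arrival model): there is a ground set $I$ of offline vertices; hyperedges, each a subset of $I$, arrive one at a time in an order chosen by an adversary (the instance, i.e. the hypergraph together with the arrival order, is fixed in advance, independently of the algorithm's random choices). In the $k$-uniform version every hyperedge has exactly $k$ vertices. When a hyperedge arrives, the online algorithm must immediately and irrevocably decide whether to add it to its matching; it may add it only if it is disjoint from all previously added hyperedges. The algorithm's value $\mathrm{ALG}$ is the number of hyperedges it adds. $\mathrm{OPT}$ denotes the maximum size of a matching (set of pairwise disjoint hyperedges) in the instance. A (randomized) online algorithm is $c$-competitive if for every instance $\mathbb{E}[\mathrm{ALG}]\ge c\cdot \mathrm{OPT}$. *)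

theory Defs
  imports "HOL-Probability.Probability"
begin

text \<open>
  Vertices are labelled by natural numbers. An instance consists of the finite ground set \<open>I\<close> of
  offline vertices and the list \<open>es\<close> of hyperedges in arrival order.
\<close>

definition uniform_instance :: "nat \<Rightarrow> nat set \<Rightarrow> nat set list \<Rightarrow> bool" where
  "uniform_instance k I es \<longleftrightarrow>
     finite I \<and> distinct es \<and> (\<forall>e \<in> set es. e \<subseteq> I \<and> card e = k)"

definition matching :: "nat set list \<Rightarrow> nat set set \<Rightarrow> bool" where
  "matching es S \<longleftrightarrow> S \<subseteq> set es \<and> pairwise disjnt S"

definition opt :: "nat set list \<Rightarrow> nat" where
  "opt es = Max (card ` {S. matching es S})"

text \<open>
  A deterministic algorithm knows the ground set in advance. On the arrival of a hyperedge it sees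
  the list of all hyperedges that have arrived so far, the current one being the last, and
  answers whether the current one is added. Its own earlier decisions are determined by the
  earlier hyperedges, so they are not a separate argument.
\<close>

type_synonym algorithm = "nat set \<Rightarrow> nat set list \<Rightarrow> bool"

definition adds :: "algorithm \<Rightarrow> nat set \<Rightarrow> nat set list \<Rightarrow> nat \<Rightarrow> bool" where
  "adds A I es i \<longleftrightarrow> A I (take (Suc i) es)"

definition online_algorithm :: "nat \<Rightarrow> algorithm \<Rightarrow> bool" where
  "online_algorithm k A \<longleftrightarrow>
     (\<forall>I es. uniform_instance k I es \<longrightarrow>
        (\<forall>i < length es. \<forall>j < i. adds A I es i \<and> adds A I es j \<longrightarrow> disjnt (es ! i) (es ! j)))"

definition alg_value :: "algorithm \<Rightarrow> nat set \<Rightarrow> nat set list \<Rightarrow> nat" where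
  "alg_value A I es = card {i. i < length es \<and> adds A I es i}"

text \<open>
  A randomized algorithm is a probability distribution on deterministic algorithms, for an
  arbitrary \<open>\<sigma>\<close>-algebra in which every single decision is an event. An algorithm driven by random
  seeds from any probability space induces such a distribution.
\<close>

definition randomized_online_algorithm :: "nat \<Rightarrow> algorithm measure \<Rightarrow> bool" where
  "randomized_online_algorithm k M \<longleftrightarrow>
     prob_space M \<and> (\<forall>A \<in> space M. online_algorithm k A) \<and>
     (\<forall>I es. uniform_instance k I es \<longrightarrow>
        (\<forall>i < length es. {A \<in> space M. adds A I es i} \<in> sets M))"

definition competitive :: "nat \<Rightarrow> real \<Rightarrow> algorithm measure \<Rightarrow> bool" where
  "competitive k c M \<longleftrightarrow>
     (\<forall>I es. uniform_instance k I es \<longrightarrow>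
        prob_space.expectation M (\<lambda>A. real (alg_value A I es)) \<ge> c * real (opt es))"

end

theory Submission imports Defs begin

text \<open>
  A random adversary with \<open>k - 1\<close> fair coins defeats every algorithm. In round \<open>r < k - 1\<close> two
  intersecting hyperedges arrive, and only afterwards the coin \<open>c ! r\<close> decides which of them is
  \<^emph>\<open>bad\<close>: all later hyperedges meet the bad one and avoid the good one. A final round consists
  of a single hyperedge. The good hyperedges and the final one form a matching of size \<open>k\<close>. An
  algorithm that picks a hyperedge is blocked forever with probability one half, so it picks at
  most \<open>1 + 1/2 + \<dots> + 1/2^(k - 1) < 2\<close> hyperedges on average. Hence even the ratio \<open>2/k\<close> is out of
  reach, and \<open>f = 0\<close> will do.

  Round \<open>r\<close> leaves room for exactly this: both of its hyperedges contain the vertex \<open>Inl r\<close>, which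
  makes them intersect, one vertex \<open>Inr (s, c ! s, r)\<close> of the bad hyperedge of each round \<open>s < r\<close>,
  and one private vertex \<open>Inr (r, b, i)\<close> for each later round \<open>i\<close>, where \<open>b\<close> tells the two apart.
\<close>

definition labelled_edge :: "nat \<Rightarrow> bool list \<Rightarrow> nat \<Rightarrow> bool \<Rightarrow> (nat + nat \<times> bool \<times> nat) set" where
  "labelled_edge k c r b =
     insert (Inl r) ((\<lambda>s. Inr (s, c ! s, r)) ` {..<r} \<union> (\<lambda>i. Inr (r, b, i)) ` {r<..<k})"

definition edge :: "nat \<Rightarrow> bool list \<Rightarrow> nat \<Rightarrow> bool \<Rightarrow> nat set" where
  "edge k c r b = to_nat ` labelled_edge k c r b"

text \<open>Both labels occur for every pair of rounds, so the ground set is the same for all coins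
  and reveals none of them.\<close>

definition vertices :: "nat \<Rightarrow> nat set" where
  "vertices k = to_nat ` (Inl ` {..<k} \<union> Inr ` ({..<k} \<times> UNIV \<times> {..<k})
     :: (nat + nat \<times> bool \<times> nat) set)"

text \<open>Position \<open>2 * r + of_bool b\<close> holds hyperedge \<open>b\<close> of round
  \<open>r\<close>. The odd length cuts off the second hyperedge of the last round, which would
  repeat the first.\<close>

definition arrivals :: "nat \<Rightarrow> bool list \<Rightarrow> nat set list" where
  "arrivals k c = map (\<lambda>i. edge k c (i div 2) (odd i)) [0..<2 * k - 1]"

section \<open>Sizes, equality and intersections of hyperedges\<close>

lemma disjnt_edge_iff:
  "disjnt (edge k c r b) (edge k c' r' b') \<longleftrightarrow>
     disjnt (labelled_edge k c r b) (labelled_edge k c' r' b')"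
  by (auto simp: edge_def disjnt_iff)

lemma card_labelled_edge:
  assumes "r < k"
  shows "card (labelled_edge k c r b) = k"
proof -
  have "card ((\<lambda>s. Inr (s, c ! s, r) :: nat + nat \<times> bool \<times> nat) ` {..<r}
          \<union> (\<lambda>i. Inr (r, b, i)) ` {r<..<k}) = r + (k - Suc r)"
    by (subst card_Un_disjoint) (auto simp: card_image inj_on_def)
  moreover have "Inl r \<notin> (\<lambda>s. Inr (s, c ! s, r) :: nat + nat \<times> bool \<times> nat) ` {..<r}
          \<union> (\<lambda>i. Inr (r, b, i)) ` {r<..<k}"
    by auto
  ultimately show ?thesis
    using assms by (simp add: labelled_edge_def)
qed

lemma card_edge: "r < k \<Longrightarrow> card (edge k c r b) = k"
  unfolding edge_def by (subst card_image) (auto simp: card_labelled_edge)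

lemma edge_eq_iff:
  "edge k c r b = edge k c' r' b' \<longleftrightarrow> labelled_edge k c r b = labelled_edge k c' r' b'"
  unfolding edge_def by (simp add: inj_image_eq_iff)

text \<open>\<open>Inl r\<close> reveals the round, and a private vertex reveals the label; the last
  round has no private vertices.\<close>

lemma edge_eqD:
  assumes "edge k c r b = edge k c r' b'"
  shows "r = r'" and "Suc r < k \<Longrightarrow> b = b'"
proof -
  have eq: "labelled_edge k c r b = labelled_edge k c r' b'"
    using assms by (simp add: edge_eq_iff)
  then have "Inl r \<in> labelled_edge k c r' b'"
    by (auto simp: labelled_edge_def)
  then show r: "r = r'"
    by (auto simp: labelled_edge_def)
  assume "Suc r < k"
  then have "Inr (r, b, Suc r) \<in> labelled_edge k c r' b'"
    unfolding eq[symmetric] by (auto simp: labelled_edge_def)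
  then show "b = b'"
    using r by (auto simp: labelled_edge_def)
qed

lemma edge_subset_vertices: "r < k \<Longrightarrow> edge k c r b \<subseteq> vertices k"
  unfolding edge_def vertices_def labelled_edge_def by (rule image_mono) auto

text \<open>In particular coin \<open>r\<close> is still hidden while the algorithm decides on round
  \<open>r\<close>.\<close>

lemma edge_cong:
  "(\<And>s. s < r \<Longrightarrow> c ! s = c' ! s) \<Longrightarrow> edge k c r b = edge k c' r b"
  by (auto simp: edge_def labelled_edge_def)

lemma not_disjnt_same_round: "\<not> disjnt (edge k c r b) (edge k c r b')"
  unfolding disjnt_edge_iff by (auto simp: labelled_edge_def disjnt_iff)

lemma not_disjnt_bad:
  assumes "r < r'" "r' < k"
  shows "\<not> disjnt (edge k c r (c ! r)) (edge k c r' b)"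
proof -
  have "Inr (r, c ! r, r') \<in> labelled_edge k c r (c ! r) \<inter> labelled_edge k c r' b"
    using assms by (auto simp: labelled_edge_def)
  then show ?thesis
    unfolding disjnt_edge_iff by (auto simp: disjnt_def)
qed

text \<open>A later hyperedge takes from round \<open>r\<close> only a vertex labelled
  \<open>c ! r\<close>, while the private vertices of the good one have the opposite label. Its
  other vertices end in \<open>r\<close>, those of a later hyperedge in \<open>r'\<close> or
  more.\<close>

lemma disjnt_good: "r < r' \<Longrightarrow> disjnt (edge k c r (\<not> c ! r)) (edge k c r' b)"
  unfolding disjnt_edge_iff by (auto simp: labelled_edge_def disjnt_iff)

section \<open>The instances and their optimum\<close>

lemma length_arrivals [simp]: "length (arrivals k c) = 2 * k - 1"
  by (simp add: arrivals_def)

lemma arrivals_nth: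
  "i < 2 * k - 1 \<Longrightarrow> arrivals k c ! i = edge k c (i div 2) (odd i)"
  by (simp add: arrivals_def)

lemma uniform_instance_arrivals: "uniform_instance k (vertices k) (arrivals k c)"
proof -
  have "distinct (arrivals k c)"
    unfolding distinct_conv_nth
  proof (intro allI impI notI)
    fix i j
    assume ij: "i < length (arrivals k c)" "j < length (arrivals k c)" "i \<noteq> j"
      and "arrivals k c ! i = arrivals k c ! j"
    then have eq: "edge k c (i div 2) (odd i) = edge k c (j div 2) (odd j)"
      by (simp add: arrivals_nth)
    have div: "i div 2 = j div 2"
      using edge_eqD(1)[OF eq] .
    have "2 * (i div 2) \<le> i" "2 * (i div 2) \<le> j"
      using times_div_less_eq_dividend[of 2 i] times_div_less_eq_dividend[of 2 j]
      unfolding div by simp_all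
    \<comment> \<open>Two positions share this round, so the larger is at least
      \<open>2 * (i div 2) + 1\<close>, which rules out the last round.\<close>
    then have "Suc (i div 2) < k"
      using ij unfolding length_arrivals by linarith
    then have "odd i = odd j"
      using edge_eqD(2)[OF eq] by simp
    then show False
      using div ij(3) by presburger
  qed
  moreover have "e \<subseteq> vertices k \<and> card e = k" if "e \<in> set (arrivals k c)" for e
  proof -
    from that obtain i where "i < 2 * k - 1" "e = edge k c (i div 2) (odd i)"
      by (auto simp: arrivals_def)
    then show ?thesis
      using edge_subset_vertices[of "i div 2" k] card_edge[of "i div 2" k] by auto
  qed
  ultimately show ?thesis
    by (auto simp: uniform_instance_def vertices_def)
qed

lemma opt_arrivals_ge: "k \<le> opt (arrivals k c)"
proof -
  define g where "g = (\<lambda>r. edge k c r (\<not> c ! r))"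
  have "inj_on g {..<k}"
    by (rule inj_onI) (auto simp: g_def dest: edge_eqD(1))
  then have card: "card (g ` {..<k}) = k"
    by (simp add: card_image)
  have mem: "g r \<in> set (arrivals k c)" if "r < k" for r
  proof (cases "Suc r < k")
    case True
    let ?i = "2 * r + of_bool (\<not> c ! r)"
    have "?i < 2 * k - 1"
      using True by auto
    moreover have "g r = edge k c (?i div 2) (odd ?i)"
      by (simp add: g_def)
    ultimately show ?thesis
      unfolding arrivals_def by (metis (lifting) atLeast_upt image_eqI lessThan_iff
          list.set_map)
  next
    case False
    \<comment> \<open>In the last round the label has no effect, so it is harmless if
      \<open>c ! r\<close> lies beyond the end of \<open>c\<close>.\<close>
    then have "g r = edge k c r False"
      by (auto simp: g_def edge_def labelled_edge_def)
    also have "\<dots> = arrivals k c ! (2 * r)"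
      using that by (simp add: arrivals_nth)
    also have "\<dots> \<in> set (arrivals k c)"
      using that by (intro nth_mem) simp
    finally show ?thesis .
  qed
  have "disjnt (g r) (g r')" if "r \<noteq> r'" for r r'
    using that disjnt_good[of r r' k c] disjnt_good[of r' r k c]
    by (cases r r' rule: linorder_cases) (auto simp: g_def disjnt_sym)
  then have "pairwise disjnt (g ` {..<k})"
    by (intro pairwise_imageI) auto
  then have "matching (arrivals k c) (g ` {..<k})"
    using mem by (simp add: matching_def image_subset_iff)
  moreover have "finite {S. matching (arrivals k c) S}"
    by (rule finite_subset[of _ "Pow (set (arrivals k c))"]) (auto simp: matching_def)
  ultimately show ?thesis
    unfolding opt_def by (intro Max_ge) (auto intro!: rev_image_eqI simp: card)
qed

section \<open>Averaging over coin sequences\<close>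

lemma coins_Suc:
  "{q :: bool list. length q = Suc m} =
     (#) True ` {q. length q = m} \<union> (#) False ` {q. length q = m}"
  by (auto simp: length_Suc_conv image_iff)

lemma finite_coins [simp]: "finite {q :: bool list. length q = m}"
  using finite_lists_length_eq[of "UNIV :: bool set" m] by simp

lemma card_coins [simp]: "card {q :: bool list. length q = m} = 2 ^ m"
  using card_lists_length_eq[of "UNIV :: bool set" m] by simp

text \<open>
  \<open>picked p b\<close> means that after the coins \<open>p\<close> the algorithm picks hyperedge \<open>b\<close> of the next round;
  if the next coin is also \<open>b\<close>, the assumption says that nothing is picked any more.
\<close>

lemma sum_rounds_picked_less:
  fixes picked :: "bool list \<Rightarrow> bool \<Rightarrow> bool"
  assumes blocked: "\<And>p b q b'. \<lbrakk>length (p @ b # q) \<le> n; picked p b\<rbrakk> \<Longrightarrow> \<not> picked (p @ b # q) b'"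
    and "length p + m = n"
  shows "(\<Sum>q | length q = m. card {j. j \<le> m \<and> (\<exists>b. picked (p @ take j q) b)}) < 2 * 2 ^ m"
  using assms(2)
proof (induction m arbitrary: p)
  case 0
  have "card {j :: nat. j = 0 \<and> (\<exists>b. picked p b)} \<le> card {0::nat}"
    by (rule card_mono) auto
  then show ?case
    by simp
next
  case (Suc m)
  define S where
    "S = (\<lambda>p. \<Sum>q | length q = m. card {j. j \<le> m \<and> (\<exists>b. picked (p @ take j q) b)})"
  define x where "x = (of_bool (\<exists>b. picked p b) :: nat)"
  have split: "card {j. j \<le> Suc m \<and> (\<exists>b'. picked (p @ take j (b # q)) b')} =
      x + card {j. j \<le> m \<and> (\<exists>b'. picked ((p @ [b]) @ take j q) b')}" for b q
  proof -
    have "{j. j \<le> Suc m \<and> (\<exists>b'. picked (p @ take j (b # q)) b')} =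
        {j. j = 0 \<and> (\<exists>b. picked p b)} \<union>
        Suc ` {j. j \<le> m \<and> (\<exists>b'. picked ((p @ [b]) @ take j q) b')}"
      (is "?L = ?R")
    proof (rule set_eqI)
      show "j \<in> ?L \<longleftrightarrow> j \<in> ?R" for j
        by (cases j) auto
    qed
    also have "card \<dots> = card {j :: nat. j = 0 \<and> (\<exists>b. picked p b)} +
        card (Suc ` {j. j \<le> m \<and> (\<exists>b'. picked ((p @ [b]) @ take j q) b')})"
      by (rule card_Un_disjoint) auto
    finally show ?thesis
      by (simp add: card_image x_def)
  qed
  have total: "(\<Sum>q | length q = Suc m. card {j. j \<le> Suc m \<and> (\<exists>b. picked (p @ take j q) b)}) =
      2 * 2 ^ m * x + S (p @ [True]) + S (p @ [False])"
    unfolding coins_Suc S_def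
    by (subst sum.union_disjoint)
      (auto simp: sum.reindex split sum.distrib simp del: take_Suc_Cons append_assoc)
  have bound: "S (p @ [b]) < 2 * 2 ^ m" for b
    unfolding S_def using Suc.prems by (intro Suc.IH) simp
  have zero: "S (p @ [b]) = 0" if "picked p b" for b
    unfolding S_def
  proof (rule sum.neutral, rule ballI)
    fix q :: "bool list"
    assume "q \<in> {q. length q = m}"
    then have "\<not> picked (p @ b # take j q) b'" for j b'
      using Suc.prems by (intro blocked[OF _ that]) simp
    then show "card {j. j \<le> m \<and> (\<exists>b'. picked ((p @ [b]) @ take j q) b')} = 0"
      by simp
  qed
  \<comment> \<open>A pick now gains 1 on each of the \<open>2 * 2 ^ m\<close> coin sequences but
    makes one of the two branches worthless; without a pick both branches count. Either way the
    total stays below \<open>4 * 2 ^ m\<close>.\<close>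
  show ?case
  proof (cases "\<exists>b. picked p b")
    case True
    then obtain b where "picked p b" by blast
    then show ?thesis
      unfolding total using zero[of b] bound[of "\<not> b"] by (cases b) (auto simp: x_def)
  next
    case False
    then show ?thesis
      unfolding total using bound[of True] bound[of False] by (simp add: x_def)
  qed
qed

text \<open>The decision sees no round after \<open>i div 2\<close>, and the hyperedges up to that
  round depend on earlier coins alone.\<close>

lemma adds_arrivals_cong:
  assumes "i < 2 * k - 1" and "\<And>s. s < i div 2 \<Longrightarrow> c ! s = c' ! s"
  shows "adds A I (arrivals k c) i = adds A I (arrivals k c') i"
proof -
  have "take (Suc i) (arrivals k c) = take (Suc i) (arrivals k c')"
    unfolding arrivals_def take_map using assms
    by (auto intro!: edge_cong assms(2))
  then show ?thesis
    by (simp add: adds_def)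
qed

lemma sum_alg_value_less:
  assumes A: "online_algorithm k A" and "0 < k"
  shows "(\<Sum>c | length c = k - 1. alg_value A (vertices k) (arrivals k c)) < 2 * 2 ^ (k - 1)"
proof -
  \<comment> \<open>The list \<open>p\<close> may be too short for \<open>arrivals k p\<close>, but
    its unspecified entries only affect rounds after \<open>length p\<close>. The bound excludes the
    missing second hyperedge of the last round.\<close>
  define picked where "picked = (\<lambda>p b. 2 * length p + of_bool b < 2 * k - 1 \<and>
    adds A (vertices k) (arrivals k p) (2 * length p + of_bool b))"
  have disj: "disjnt (arrivals k c ! i) (arrivals k c ! j)"
    if "adds A (vertices k) (arrivals k c) i" "adds A (vertices k) (arrivals k c) j"
       "i < 2 * k - 1" "j < i" for c i j
    using A uniform_instance_arrivals[of k c] that by (auto simp: online_algorithm_def)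
  have blocked: "\<not> picked (p @ b # q) b'"
    if len: "length (p @ b # q) \<le> k - 1" and p: "picked p b" for p b q b'
  proof
    let ?c = "p @ b # q"
    let ?i = "2 * length p + of_bool b" and ?j = "2 * length ?c + of_bool b'"
    assume "picked ?c b'"
    then have j: "?j < 2 * k - 1" "adds A (vertices k) (arrivals k ?c) ?j"
      by (auto simp: picked_def)
    have i: "?i < 2 * k - 1" "adds A (vertices k) (arrivals k p) ?i"
      using p by (auto simp: picked_def)
    have "adds A (vertices k) (arrivals k ?c) ?i"
      using i(2) by (subst adds_arrivals_cong[OF i(1), of _ p]) (auto simp: nth_append)
    moreover have "?i < ?j"
      by auto
    ultimately have "disjnt (arrivals k ?c ! ?j) (arrivals k ?c ! ?i)"
      using j by (intro disj)
    moreover have "arrivals k ?c ! ?i = edge k ?c (length p) (?c ! length p)"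
      using arrivals_nth[OF i(1), of ?c] by (simp add: nth_append)
    moreover have "arrivals k ?c ! ?j = edge k ?c (length ?c) b'"
      unfolding arrivals_nth[OF j(1)] by (simp del: length_append)
    ultimately have "disjnt (edge k ?c (length ?c) b') (edge k ?c (length p) (?c ! length p))"
      by simp
    moreover have "length p < length ?c" "length ?c < k"
      using len \<open>0 < k\<close> by auto
    ultimately show False
      using not_disjnt_bad disjnt_sym by blast
  qed
  have "alg_value A (vertices k) (arrivals k c) \<le>
      card {j. j \<le> k - 1 \<and> (\<exists>b. picked ([] @ take j c) b)}"
    if "length c = k - 1" for c
    unfolding alg_value_def
  \<comment> \<open>Hyperedges of one round intersect, so picks can be counted by their
    rounds.\<close>
  proof (rule card_inj_on_le[where f = "\<lambda>i. i div 2"])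
    let ?P = "{i. i < length (arrivals k c) \<and> adds A (vertices k) (arrivals k c) i}"
    show "inj_on (\<lambda>i. i div 2) ?P"
    proof (rule linorder_inj_onI')
      fix i j
      assume ij: "i \<in> ?P" "j \<in> ?P" "i < j"
      then have "disjnt (arrivals k c ! j) (arrivals k c ! i)"
        by (intro disj) auto
      then show "i div 2 \<noteq> j div 2"
        using ij not_disjnt_same_round by (auto simp: arrivals_nth)
    qed
    show "(\<lambda>i. i div 2) ` ?P \<subseteq> {j. j \<le> k - 1 \<and> (\<exists>b. picked ([] @ take j c) b)}"
    proof safe
      fix i
      assume i: "i < length (arrivals k c)" "adds A (vertices k) (arrivals k c) i"
      then show le: "i div 2 \<le> k - 1"
        by simp
      have eq: "2 * (i div 2) + of_bool (odd i) = i"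
        by (metis mult_div_mod_eq mod2_eq_if of_bool_eq(1) of_bool_eq(2))
      have "adds A (vertices k) (arrivals k (take (i div 2) c)) i"
        using i by (subst adds_arrivals_cong[of _ _ _ c]) auto
      then have "picked (take (i div 2) c) (odd i)"
        using i(1) le that eq by (simp add: picked_def min_absorb2)
      then show "\<exists>b. picked ([] @ take (i div 2) c) b"
        by auto
    qed
  qed auto
  then have "(\<Sum>c | length c = k - 1. alg_value A (vertices k) (arrivals k c)) \<le>
      (\<Sum>c | length c = k - 1. card {j. j \<le> k - 1 \<and> (\<exists>b. picked ([] @ take j c) b)})"
    by (intro sum_mono) auto
  also have "\<dots> < 2 * 2 ^ (k - 1)"
    by (rule sum_rounds_picked_less[where n = "k - 1"]) (use blocked in auto)
  finally show ?thesis .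
qed

section \<open>Randomized algorithms\<close>

lemma integrable_alg_value:
  assumes M: "randomized_online_algorithm k M" and inst: "uniform_instance k I es"
  shows "integrable M (\<lambda>A. real (alg_value A I es))"
proof -
  interpret prob_space M
    using M by (simp add: randomized_online_algorithm_def)
  have "integrable M (\<lambda>A. \<Sum>i<length es. indicat_real {A \<in> space M. adds A I es i} A)"
    using M inst
    by (intro Bochner_Integration.integrable_sum integrable_real_indicator)
      (auto simp: randomized_online_algorithm_def emeasure_eq_measure)
  moreover have "real (alg_value A I es) =
      (\<Sum>i<length es. indicat_real {A \<in> space M. adds A I es i} A)" if "A \<in> space M" for A
    using that by (simp add: alg_value_def indicator_def sum.If_cases Int_def)
  ultimately show ?thesis
    by (simp cong: Bochner_Integration.integrable_cong)
qed

text \<open>Yao's principle: exchanging the sum over coins with the expectation reduces the claim to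
  deterministic algorithms.\<close>

lemma not_competitive_two_div:
  assumes "0 < k" and M: "randomized_online_algorithm k M"
  shows "\<not> competitive k (2 / real k) M"
proof
  assume comp: "competitive k (2 / real k) M"
  interpret prob_space M
    using M by (simp add: randomized_online_algorithm_def)
  let ?v = "\<lambda>c A. real (alg_value A (vertices k) (arrivals k c))"
  have int: "integrable M (?v c)" for c
    using M uniform_instance_arrivals by (rule integrable_alg_value)
  have "2 \<le> expectation (?v c)" for c
  proof -
    have "2 = 2 / real k * real k"
      using \<open>0 < k\<close> by simp
    also have "\<dots> \<le> 2 / real k * real (opt (arrivals k c))"
      using opt_arrivals_ge[of k c] by (intro mult_left_mono) auto
    also have "\<dots> \<le> expectation (?v c)"
      using comp uniform_instance_arrivals by (simp add: competitive_def)
    finally show ?thesis .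
  qed
  then have "(\<Sum>c :: bool list | length c = k - 1. 2) \<le> (\<Sum>c | length c = k - 1. expectation (?v c))"
    by (intro sum_mono)
  also have "\<dots> = expectation (\<lambda>A. \<Sum>c | length c = k - 1. ?v c A)"
    using int by (intro Bochner_Integration.integral_sum[symmetric])
  \<comment> \<open>The strict bound is between integers, so it leaves a gap of 1 that survives
    integration.\<close>
  also have "\<dots> \<le> expectation (\<lambda>A. 2 * 2 ^ (k - 1) - 1)"
  proof (rule integral_mono)
    fix A
    assume "A \<in> space M"
    then have "(\<Sum>c | length c = k - 1. alg_value A (vertices k) (arrivals k c)) + 1 \<le> 2 * 2 ^ (k - 1)"
      using sum_alg_value_less[of k A] M \<open>0 < k\<close>
      by (simp add: randomized_online_algorithm_def Suc_le_eq)
    then have "real ((\<Sum>c | length c = k - 1. alg_value A (vertices k) (arrivals k c)) + 1)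
        \<le> real (2 * 2 ^ (k - 1))"
      by (rule of_nat_mono)
    then show "(\<Sum>c | length c = k - 1. ?v c A) \<le> 2 * 2 ^ (k - 1) - 1"
      by simp
  qed (use int in auto)
  also have "\<dots> = 2 * 2 ^ (k - 1) - 1"
    by (simp add: prob_space)
  finally show False
    by simp
qed

theorem theorem3:
  "\<exists>f :: nat \<Rightarrow> real.
     (\<forall>k. f k \<ge> 0) \<and> f \<longlonglongrightarrow> 0 \<and>
     (\<forall>k \<ge> 2. \<not> (\<exists>M. randomized_online_algorithm k M \<and> competitive k ((2 + f k) / real k) M))"
  by (rule exI[of _ "\<lambda>_. 0"]) (use not_competitive_two_div in force)

end
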